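(* Let $\mathsf F:X\to X^\star$ satisfy (F1), (F2), (F3), let the forms $a(u;\cdot,\cdot)$ be uniformly coercive and bounded with constants $\alpha,\beta>0$, let (F4) hold for the discrete iterations with constant $C_{\mathsf H}>0$, and let the error estimators $\eta_N$ satisfy (A1) and (A2) with constants $C_{A1},C_{A2}\ge1$. Set $$C_1:=1+\frac{\beta}{\nu},\quad C_\lambda:=C_1C_{A1},\quad C_2:=\frac{L_{\mathsf F}C_1^2}{2C_{\mathsf H}},$$ let $\lambda\in(0,C_\lambda^{-1})$ be the parameter of the adaptive ILG algorithm, and set $$C_3:=\lambda C_1+C_{A2}(1+\lambda C_\lambda),\qquad C:=\frac{L_{\mathsf F}^{1/2}C_2^{1/2}C_3}{\sqrt2\,C_{\mathsf H}^{1/2}},\qquad C':=\frac{C\,C_{A1}C_2^{1/2}}{1-(1+C_2^{-1})^{-1/2}} .$$ Suppose that the inner (while) loop of the adaptive ILG algorithm terminates after finitely many steps with $\eta_N(u_N)>0$ for all $N\ge0$. Then the number $\#\mathrm{It}(N)$ of iterative linearization steps performed on $X_N$ satisfies, for all $N\ge1$, $$\#\mathrm{It}(N)\le\frac{2}{\log(1+C_2^{-1})}\log\left(\left(C\lambda^{-1}+C'\right)\left(1+C_2^{-1}\right)\max\left\{1,\frac{\eta_{N-1}(u_{N-1})}{\eta_N(u_N)}\right\}\right)+1 .$$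
   Context: $X$ is a real Hilbert space with norm $\|\cdot\|_X$, dual $X^\star$ and duality pairing $\langle\cdot,\cdot\rangle$ on $X^\star\times X$. Conditions on $\mathsf F:X\to X^\star$: (F1) there is $L_{\mathsf F}>0$ with $|\langle \mathsf F(u)-\mathsf F(v),w\rangle|\le L_{\mathsf F}\|u-v\|_X\|w\|_X$ for all $u,v,w\in X$; (F2) there is $\nu>0$ with $\nu\|u-v\|_X^2\le\langle \mathsf F(u)-\mathsf F(v),u-v\rangle$ for all $u,v\in X$; (F3) there is a Gâteaux differentiable functional $\mathsf H:X\to\mathbb R$ with $\mathsf H'=\mathsf F$. Under (F1)–(F2), $\mathsf F(u)=0$ has a unique solution $u^\star\in X$. For each $v\in X$, $\mathsf A[v]:X\to X^\star$ is a given linear invertible operator; $a(u;v,w):=\langle \mathsf A[u]v,w\rangle$ and $f(u):=\mathsf A[u]u-\mathsf F(u)\in X^\star$. Uniform coercivity and boundedness mean: there are $\alpha,\beta>0$, independent of $u\in X$, with $a(u;v,v)\ge\alpha\|v\|_X^2$ and $a(u;v,w)\le\beta\|v\|_X\|w\|_X$ for all $u,v,w\in X$. $X_0\subset X_1\subset X_2\subset\cdots\subset X$ are finite dimensional subspaces. $u_N^\star\in X_N$ is the unique solution of $\langle \mathsf F(u_N^\star),v\rangle=0$ for all $v\in X_N$. For each $N\ge0$, $\eta_N:X_N\to[0,\infty)$ is a function (error estimator). With constants $C_{A1},C_{A2}\ge1$ independent of $N$: (A1) $|\eta_N(u)-\eta_N(v)|\le C_{A1}\|u-v\|_X$ for all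 $u,v\in X_N$; (A2) $\|u^\star-u_N^\star\|_X\le C_{A2}\,\eta_N(u_N^\star)$. Adaptive ILG algorithm with parameter $\lambda>0$: start with $X_0$ and an arbitrary $u_0^0\in X_0$. For $N=0,1,2,\dots$: starting from $u_N^0\in X_N$, compute for $n=0,1,2,\dots$ the solution $u_N^{n+1}\in X_N$ of $a(u_N^n;u_N^{n+1},v)=\langle f(u_N^n),v\rangle$ for all $v\in X_N$, and stop this inner (while) loop at the first index $n\ge1$ for which $\|u_N^n-u_N^{n-1}\|_X\le\lambda\,\eta_N(u_N^n)$; this index is denoted $\#\mathrm{It}(N)$. Set $u_N:=u_N^n$ for this index, enrich $X_N$ to $X_{N+1}\supset X_N$ (based on $\eta_N(u_N)$), and set $u_{N+1}^0:=u_N$. The outer loop is run for all $N\ge0$. (F4) for the discrete iterations: there is $C_{\mathsf H}>0$, independent of $N$, such that for every $N\ge0$ the sequence $\{u_N^n\}_{n\ge0}\subset X_N$ obtained from $u_N^0$ by solving, for $n=0,1,2,\dots$, the linear discrete problems of finding $u_N^{n+1}\in X_N$ with $a(u_N^n;u_N^{n+1},v)=\langle f(u_N^n),v\rangle$ for all $v\in X_N$, satisfies $\mathsf H(u_N^{n-1})-\mathsf H(u_N^n)\ge C_{\mathsf H}\|u_N^n-u_N^{n-1}\|_X^2$ for all $n\ge1$. *)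

theory Defs
  imports "HOL-Analysis.Analysis"
begin

text \<open>
  The Hilbert space is a type of sort \<open>{real_inner, complete_space}\<close>, its dual is the type of
  bounded linear functionals \<open>'a \<Rightarrow>\<^sub>L real\<close>, and the duality pairing is \<open>blinfun_apply\<close>.
\<close>

definition cond_F1 :: "('a::real_inner \<Rightarrow> 'a \<Rightarrow>\<^sub>L real) \<Rightarrow> real \<Rightarrow> bool" where
  "cond_F1 F L \<longleftrightarrow> L > 0 \<and>
     (\<forall>u v w. \<bar>blinfun_apply (F u - F v) w\<bar> \<le> L * norm (u - v) * norm w)"

definition cond_F2 :: "('a::real_inner \<Rightarrow> 'a \<Rightarrow>\<^sub>L real) \<Rightarrow> real \<Rightarrow> bool" where
  "cond_F2 F \<nu> \<longleftrightarrow> \<nu> > 0 \<and>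
     (\<forall>u v. \<nu> * (norm (u - v))\<^sup>2 \<le> blinfun_apply (F u - F v) (u - v))"

definition has_gateaux_derivative ::
  "('a::real_inner \<Rightarrow> real) \<Rightarrow> ('a \<Rightarrow>\<^sub>L real) \<Rightarrow> 'a \<Rightarrow> bool" where
  "has_gateaux_derivative H D u \<longleftrightarrow>
     (\<forall>w. ((\<lambda>t::real. (H (u + t *\<^sub>R w) - H u) / t) \<longlongrightarrow> blinfun_apply D w) (at 0))"

definition cond_F3 :: "('a::real_inner \<Rightarrow> 'a \<Rightarrow>\<^sub>L real) \<Rightarrow> ('a \<Rightarrow> real) \<Rightarrow> bool" where
  "cond_F3 F H \<longleftrightarrow> (\<forall>u. has_gateaux_derivative H (F u) u)"

definition form_a :: "('a::real_inner \<Rightarrow> 'a \<Rightarrow> 'a \<Rightarrow>\<^sub>L real) \<Rightarrow> 'a \<Rightarrow> 'a \<Rightarrow> 'a \<Rightarrow> real" where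
  "form_a A u v w = blinfun_apply (A u v) w"

definition rhs_f ::
  "('a::real_inner \<Rightarrow> 'a \<Rightarrow> 'a \<Rightarrow>\<^sub>L real) \<Rightarrow> ('a \<Rightarrow> 'a \<Rightarrow>\<^sub>L real) \<Rightarrow> 'a \<Rightarrow> 'a \<Rightarrow>\<^sub>L real" where
  "rhs_f A F u = A u u - F u"

definition uniformly_coercive :: "('a::real_inner \<Rightarrow> 'a \<Rightarrow> 'a \<Rightarrow>\<^sub>L real) \<Rightarrow> real \<Rightarrow> bool" where
  "uniformly_coercive A \<alpha> \<longleftrightarrow> \<alpha> > 0 \<and> (\<forall>u v. form_a A u v v \<ge> \<alpha> * (norm v)\<^sup>2)"

definition uniformly_bounded :: "('a::real_inner \<Rightarrow> 'a \<Rightarrow> 'a \<Rightarrow>\<^sub>L real) \<Rightarrow> real \<Rightarrow> bool" where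
  "uniformly_bounded A \<beta> \<longleftrightarrow> \<beta> > 0 \<and> (\<forall>u v w. form_a A u v w \<le> \<beta> * norm v * norm w)"

definition finite_dim_subspace :: "'a::real_vector set \<Rightarrow> bool" where
  "finite_dim_subspace S \<longleftrightarrow> subspace S \<and> (\<exists>B. finite B \<and> span B = S)"

definition galerkin_solution :: "('a::real_inner \<Rightarrow> 'a \<Rightarrow>\<^sub>L real) \<Rightarrow> 'a set \<Rightarrow> 'a \<Rightarrow> bool" where
  "galerkin_solution F S u \<longleftrightarrow> u \<in> S \<and> (\<forall>v\<in>S. blinfun_apply (F u) v = 0)"

text \<open>An estimator \<open>\<eta> N\<close> is a total function, but only its values on \<open>X N\<close> are ever constrained.\<close>

definition error_estimators :: "(nat \<Rightarrow> 'a set) \<Rightarrow> (nat \<Rightarrow> 'a \<Rightarrow> real) \<Rightarrow> bool" where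
  "error_estimators X \<eta> \<longleftrightarrow> (\<forall>N. \<forall>v\<in>X N. \<eta> N v \<ge> 0)"

definition cond_A1 ::
  "(nat \<Rightarrow> 'a::real_inner set) \<Rightarrow> (nat \<Rightarrow> 'a \<Rightarrow> real) \<Rightarrow> real \<Rightarrow> bool" where
  "cond_A1 X \<eta> CA1 \<longleftrightarrow> CA1 \<ge> 1 \<and>
     (\<forall>N. \<forall>u\<in>X N. \<forall>v\<in>X N. \<bar>\<eta> N u - \<eta> N v\<bar> \<le> CA1 * norm (u - v))"

definition cond_A2 ::
  "(nat \<Rightarrow> 'a \<Rightarrow> real) \<Rightarrow> 'a::real_inner \<Rightarrow> (nat \<Rightarrow> 'a) \<Rightarrow> real \<Rightarrow> bool" where
  "cond_A2 \<eta> ustar uNstar CA2 \<longleftrightarrow> CA2 \<ge> 1 \<and>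
     (\<forall>N. norm (ustar - uNstar N) \<le> CA2 * \<eta> N (uNstar N))"

text \<open>
  The full sequence of linearized discrete solves on \<open>S\<close>, started at \<open>x 0\<close> and not stopped by
  any criterion.
\<close>

definition ilg_iteration ::
  "('a::real_inner \<Rightarrow> 'a \<Rightarrow> 'a \<Rightarrow>\<^sub>L real) \<Rightarrow> ('a \<Rightarrow> 'a \<Rightarrow>\<^sub>L real) \<Rightarrow> 'a set \<Rightarrow> (nat \<Rightarrow> 'a) \<Rightarrow> bool" where
  "ilg_iteration A F S x \<longleftrightarrow> x 0 \<in> S \<and>
     (\<forall>n. x (Suc n) \<in> S \<and>
       (\<forall>v\<in>S. form_a A (x n) (x (Suc n)) v = blinfun_apply (rhs_f A F (x n)) v))"

definition stop_crit :: "('a::real_inner \<Rightarrow> real) \<Rightarrow> real \<Rightarrow> (nat \<Rightarrow> 'a) \<Rightarrow> nat \<Rightarrow> bool" where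
  "stop_crit e lam x n \<longleftrightarrow> n \<ge> 1 \<and> norm (x n - x (n - 1)) \<le> lam * e (x n)"

definition inner_terminates :: "('a::real_inner \<Rightarrow> real) \<Rightarrow> real \<Rightarrow> (nat \<Rightarrow> 'a) \<Rightarrow> bool" where
  "inner_terminates e lam x \<longleftrightarrow> (\<exists>n. stop_crit e lam x n)"

text \<open>The number of inner steps; meaningful only if \<open>inner_terminates e lam x\<close>.\<close>

definition num_it :: "('a::real_inner \<Rightarrow> real) \<Rightarrow> real \<Rightarrow> (nat \<Rightarrow> 'a) \<Rightarrow> nat" where
  "num_it e lam x = (LEAST n. stop_crit e lam x n)"

definition final_iterate :: "('a::real_inner \<Rightarrow> real) \<Rightarrow> real \<Rightarrow> (nat \<Rightarrow> 'a) \<Rightarrow> 'a" where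
  "final_iterate e lam x = x (num_it e lam x)"

text \<open>
  \<open>u N n\<close> is the \<open>n\<close>-th iterate on \<open>X N\<close>. The inner iteration is recorded for all \<open>n\<close>, also past
  the stopping index, but only \<open>final_iterate\<close> is handed on to the next space.
\<close>

definition adaptive_ilg ::
  "('a::real_inner \<Rightarrow> 'a \<Rightarrow> 'a \<Rightarrow>\<^sub>L real) \<Rightarrow> ('a \<Rightarrow> 'a \<Rightarrow>\<^sub>L real) \<Rightarrow> (nat \<Rightarrow> 'a set) \<Rightarrow>
   (nat \<Rightarrow> 'a \<Rightarrow> real) \<Rightarrow> real \<Rightarrow> (nat \<Rightarrow> nat \<Rightarrow> 'a) \<Rightarrow> bool" where
  "adaptive_ilg A F X \<eta> lam u \<longleftrightarrow>
     (\<forall>N. ilg_iteration A F (X N) (u N)) \<and>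
     (\<forall>N. u (Suc N) 0 = final_iterate (\<eta> N) lam (u N))"

definition cond_F4 :: "('a::real_inner \<Rightarrow> real) \<Rightarrow> (nat \<Rightarrow> nat \<Rightarrow> 'a) \<Rightarrow> real \<Rightarrow> bool" where
  "cond_F4 H u CH \<longleftrightarrow> CH > 0 \<and>
     (\<forall>N. \<forall>n\<ge>1. H (u N (n - 1)) - H (u N n) \<ge> CH * (norm (u N n - u N (n - 1)))\<^sup>2)"

end

theory Submission
  imports Defs
begin

text \<open>
  On a fixed space the energy error \<open>H (u\<^sub>N\<^sup>n) - H (u\<^sub>N\<^sup>\<star>)\<close> is at most \<open>C\<^sub>2\<close> times the energy
  decrease of the next step, so it decays like \<open>(1 + 1 / C\<^sub>2)\<close> to the power \<open>-n\<close>, and by (F4) the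
  squared increments decay at the same rate. The initial energy error is controlled by
  \<open>\<eta>\<^bsub>N-1\<^esub> (u\<^bsub>N-1\<^esub>)\<^sup>2\<close>: since \<open>u\<^sup>\<star>\<close> minimises \<open>H\<close> globally, \<open>H (u\<^sub>N\<^sup>\<star>)\<close> may be replaced
  by \<open>H (u\<^sup>\<star>)\<close>. If the loop does not stop at the last step but one, then the last two
  increments dominate \<open>\<eta>\<^sub>N (u\<^sub>N)\<close>, and taking logarithms bounds the number of steps. The constants
  are large enough because a nonzero increment forces \<open>C\<^sub>2 \<ge> 1\<close>.
\<close>

section \<open>Smoothness and convexity of the potential\<close>

lemma gateaux_line_derivative:
  assumes "cond_F3 F H"
  shows "((\<lambda>t. H (w + t *\<^sub>R h)) has_real_derivative blinfun_apply (F (w + t *\<^sub>R h)) h) (at t)"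
proof -
  have "((\<lambda>s. (H ((w + t *\<^sub>R h) + s *\<^sub>R h) - H (w + t *\<^sub>R h)) / s)
      \<longlongrightarrow> blinfun_apply (F (w + t *\<^sub>R h)) h) (at 0)"
    using assms unfolding cond_F3_def has_gateaux_derivative_def by blast
  then show ?thesis
    unfolding DERIV_def by (simp add: scaleR_add_left add.assoc)
qed

text \<open>Descent inequality: on the segment from \<open>w\<close> to \<open>v\<close>, (F1) lets
  the directional derivative of \<open>H\<close> grow by at most
  \<open>L * t * (norm h)\<^sup>2\<close>. The auxiliary \<open>g\<close> subtracts the primitive of
  this bound, so monotonicity of \<open>g\<close> replaces an integral.\<close>

lemma potential_upper_bound:
  assumes F1: "cond_F1 F L" and F3: "cond_F3 F H"
  shows "H v \<le> H w + blinfun_apply (F w) (v - w) + L / 2 * (norm (v - w))\<^sup>2"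
proof -
  define h where "h = v - w"
  define g where "g = (\<lambda>t. H (w + t *\<^sub>R h) - t * blinfun_apply (F w) h - L / 2 * t\<^sup>2 * (norm h)\<^sup>2)"
  have "g 1 \<le> g 0"
  proof (rule DERIV_nonpos_imp_nonincreasing[where f = g])
    fix t :: real assume t: "0 \<le> t" "t \<le> 1"
    let ?D = "blinfun_apply (F (w + t *\<^sub>R h)) h - blinfun_apply (F w) h - L * t * (norm h)\<^sup>2"
    have "(g has_real_derivative ?D) (at t)"
      unfolding g_def
      by (auto intro!: derivative_eq_intros gateaux_line_derivative[OF F3])
    moreover have "\<bar>blinfun_apply (F (w + t *\<^sub>R h) - F w) h\<bar> \<le> L * norm ((w + t *\<^sub>R h) - w) * norm h"
      using F1 unfolding cond_F1_def by blast
    then have "?D \<le> 0"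
      using t by (simp add: blinfun.diff_left power2_eq_square algebra_simps)
    ultimately show "\<exists>y. (g has_real_derivative y) (at t) \<and> y \<le> 0" by blast
  qed simp
  then show ?thesis unfolding g_def h_def by simp
qed

text \<open>Convexity: a monotone derivative keeps \<open>H\<close> above its tangents, which makes
  \<open>ustar\<close> a global minimiser and the Galerkin solution a minimiser on its
  space.\<close>

lemma potential_lower_bound:
  assumes F2: "cond_F2 F \<nu>" and F3: "cond_F3 F H"
  shows "H w + blinfun_apply (F w) (v - w) \<le> H v"
proof -
  define h where "h = v - w"
  define g where "g = (\<lambda>t. H (w + t *\<^sub>R h) - t * blinfun_apply (F w) h)"
  have "g 0 \<le> g 1"
  proof (rule DERIV_nonneg_imp_nondecreasing[where f = g])
    fix t :: real assume t: "0 \<le> t" "t \<le> 1"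
    let ?D = "blinfun_apply (F (w + t *\<^sub>R h)) h - blinfun_apply (F w) h"
    have "(g has_real_derivative ?D) (at t)"
      unfolding g_def
      by (auto intro!: derivative_eq_intros gateaux_line_derivative[OF F3])
    moreover have "?D \<ge> 0"
    \<comment> \<open>Monotonicity is tested with \<open>t *\<^sub>R h\<close>, so it only yields
      the sign of \<open>t * ?D\<close>; at \<open>t = 0\<close> the difference \<open>?D\<close>
      itself vanishes.\<close>
    proof (cases "t = 0")
      case False
      have "0 \<le> \<nu> * (norm ((w + t *\<^sub>R h) - w))\<^sup>2"
        using F2 unfolding cond_F2_def by simp
      also have "\<dots> \<le> blinfun_apply (F (w + t *\<^sub>R h) - F w) ((w + t *\<^sub>R h) - w)"
        using F2 unfolding cond_F2_def by blast
      also have "\<dots> = t * ?D"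
        by (simp add: blinfun.diff_left blinfun.scaleR_right)
      finally show ?thesis
        using False t by (simp add: zero_le_mult_iff)
    qed simp
    ultimately show "\<exists>y. (g has_real_derivative y) (at t) \<and> 0 \<le> y" by blast
  qed simp
  then show ?thesis unfolding g_def h_def by simp
qed

section \<open>Error and energy along the iteration on one space\<close>

text \<open>An a posteriori estimate by the computable increment: strong monotonicity is tested with
  \<open>us - x n\<close>, Galerkin orthogonality removes \<open>F us\<close>, and the scheme turns
  the residual at \<open>x n\<close> into the form applied to the increment.\<close>

lemma ilg_iteration_error:
  assumes F2: "cond_F2 F \<nu>" and lin: "\<And>v. linear (A v)"
    and bd: "uniformly_bounded A \<beta>" and S: "subspace S"
    and us: "galerkin_solution F S us" and it: "ilg_iteration A F S x"
  shows "norm (us - x n) \<le> \<beta> / \<nu> * norm (x (Suc n) - x n)"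
    and "norm (us - x (Suc n)) \<le> (1 + \<beta> / \<nu>) * norm (x (Suc n) - x n)"
proof -
  define e where "e = us - x n"
  have nu: "\<nu> > 0" using F2 unfolding cond_F2_def by blast
  have xS: "x n \<in> S"
    using it unfolding ilg_iteration_def by (cases n) auto
  have eS: "e \<in> S"
    using us xS S unfolding e_def galerkin_solution_def by (auto intro: subspace_diff)
  have "\<nu> * (norm e)\<^sup>2 \<le> blinfun_apply (F us - F (x n)) e"
    using F2 unfolding cond_F2_def e_def by blast
  also have "\<dots> = - blinfun_apply (F (x n)) e"
    using us eS unfolding galerkin_solution_def by (simp add: blinfun.diff_left)
  also have "\<dots> = form_a A (x n) (x (Suc n)) e - form_a A (x n) (x n) e"
    using it eS unfolding ilg_iteration_def
    by (simp add: rhs_f_def form_a_def blinfun.diff_left)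
  also have "\<dots> = form_a A (x n) (x (Suc n) - x n) e"
    by (simp add: form_a_def linear_diff[OF lin] blinfun.diff_left)
  also have "\<dots> \<le> \<beta> * norm (x (Suc n) - x n) * norm e"
    using bd unfolding uniformly_bounded_def by blast
  finally have "(\<nu> * norm e) * norm e \<le> (\<beta> * norm (x (Suc n) - x n)) * norm e"
    by (simp add: power2_eq_square mult.assoc)
  then have "\<nu> * norm e \<le> \<beta> * norm (x (Suc n) - x n)"
    using bd unfolding uniformly_bounded_def
    by (cases "norm e = 0") (auto simp: mult_le_cancel_right)
  then have e: "norm e \<le> \<beta> / \<nu> * norm (x (Suc n) - x n)"
    using nu by (simp add: field_simps)
  then show "norm (us - x n) \<le> \<beta> / \<nu> * norm (x (Suc n) - x n)"
    unfolding e_def .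
  have "norm (us - x (Suc n)) \<le> norm e + norm (x (Suc n) - x n)"
    unfolding e_def using norm_triangle_ineq4[of "us - x n" "x (Suc n) - x n"] by simp
  with e show "norm (us - x (Suc n)) \<le> (1 + \<beta> / \<nu>) * norm (x (Suc n) - x n)"
    by (simp add: algebra_simps)
qed

text \<open>An error bounded by a multiple of its own next decrease is a contraction in disguise:
  solving \<open>step\<close> for \<open>e (Suc n)\<close> gives the factor
  \<open>1 + inverse c\<close>.\<close>

lemma geometric_decay:
  fixes e :: "nat \<Rightarrow> real"
  assumes c: "c > 0" and step: "\<And>n. e (Suc n) \<le> c * (e n - e (Suc n))"
  shows "(1 + inverse c) ^ n * e n \<le> e 0"
proof (induction n)
  case (Suc n)
  have "(1 + inverse c) * e (Suc n) \<le> e n"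
    using step[of n] c by (simp add: field_simps)
  then have "(1 + inverse c) ^ n * ((1 + inverse c) * e (Suc n)) \<le> (1 + inverse c) ^ n * e n"
    using c by (intro mult_left_mono) auto
  then show ?case using Suc by (simp add: mult_ac)
qed simp

lemma ilg_energy_bound:
  assumes F1: "cond_F1 F L" and F2: "cond_F2 F \<nu>" and F3: "cond_F3 F H"
    and lin: "\<And>v. linear (A v)" and bd: "uniformly_bounded A \<beta>" and S: "subspace S"
    and us: "galerkin_solution F S us" and it: "ilg_iteration A F S x"
  shows "H (x n) - H us \<le> L / 2 * (1 + \<beta> / \<nu>)\<^sup>2 * (norm (x (Suc n) - x n))\<^sup>2"
proof -
  have "L > 0" using F1 unfolding cond_F1_def by blast
  have "x n \<in> S"
    using it unfolding ilg_iteration_def by (cases n) auto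
  then have "blinfun_apply (F us) (x n - us) = 0"
    using us S unfolding galerkin_solution_def by (auto intro: subspace_diff)
  then have "H (x n) - H us \<le> L / 2 * (norm (us - x n))\<^sup>2"
    using potential_upper_bound[OF F1 F3, of "x n" us] by (simp add: norm_minus_commute)
  \<comment> \<open>The factor \<open>\<beta> / \<nu>\<close> is weakened to
    \<open>1 + \<beta> / \<nu>\<close> so that \<open>C1\<close> appears in
    \<open>C2\<close>.\<close>
  also have "\<dots> \<le> L / 2 * ((1 + \<beta> / \<nu>) * norm (x (Suc n) - x n))\<^sup>2"
  proof (intro mult_left_mono power_mono)
    show "norm (us - x n) \<le> (1 + \<beta> / \<nu>) * norm (x (Suc n) - x n)"
      using ilg_iteration_error(1)[OF F2 lin bd S us it, of n] norm_ge_zero[of "x (Suc n) - x n"]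
      unfolding distrib_right by linarith
  qed (use \<open>L > 0\<close> in auto)
  finally show ?thesis by (simp add: power_mult_distrib mult.assoc)
qed

text \<open>With \<open>d\<close> the next increment, the energy error lies between
  \<open>CH * d\<^sup>2\<close> and \<open>c * CH * d\<^sup>2\<close>. The upper bound makes the
  energy error contract, the lower bound passes this decay on to the increments, and both together
  force \<open>1 \<le> c\<close> once \<open>d\<close> is nonzero.\<close>

lemma ilg_increment_decay:
  assumes F1: "cond_F1 F L" and F2: "cond_F2 F \<nu>" and F3: "cond_F3 F H"
    and lin: "\<And>v. linear (A v)" and bd: "uniformly_bounded A \<beta>" and S: "subspace S"
    and us: "galerkin_solution F S us" and it: "ilg_iteration A F S x"
    and CH: "CH > 0"
    and dec: "\<And>n. H (x n) - H (x (Suc n)) \<ge> CH * (norm (x (Suc n) - x n))\<^sup>2"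
    and c: "c = L * (1 + \<beta> / \<nu>)\<^sup>2 / (2 * CH)"
  shows "CH * ((1 + inverse c) ^ n * (norm (x (Suc n) - x n))\<^sup>2) \<le> H (x 0) - H us"
    and "x (Suc n) \<noteq> x n \<Longrightarrow> 1 \<le> c"
proof -
  define e where "e n = H (x n) - H us" for n
  have pos: "L > 0" "\<nu> > 0" "\<beta> > 0"
    using F1 F2 bd unfolding cond_F1_def cond_F2_def uniformly_bounded_def by blast+
  then have "1 + \<beta> / \<nu> > 0" by (simp add: add_pos_pos)
  then have cpos: "c > 0" unfolding c using pos CH by simp
  have xS: "x n \<in> S" for n
    using it unfolding ilg_iteration_def by (cases n) auto
  have e0: "e n \<ge> 0" for n
  proof -
    have "blinfun_apply (F us) (x n - us) = 0"
      using us xS[of n] S unfolding galerkin_solution_def by (auto intro: subspace_diff)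
    then show ?thesis
      using potential_lower_bound[OF F2 F3, of us "x n"] unfolding e_def by simp
  qed
  have up: "e n \<le> c * (CH * (norm (x (Suc n) - x n))\<^sup>2)" for n
    using ilg_energy_bound[OF F1 F2 F3 lin bd S us it, of n] CH
    unfolding e_def c by (simp add: field_simps)
  have step: "e (Suc n) \<le> c * (e n - e (Suc n))" for n
  proof -
    have "c * (CH * (norm (x (Suc n) - x n))\<^sup>2) \<le> c * (e n - e (Suc n))"
      using dec[of n] cpos unfolding e_def by (intro mult_left_mono) auto
    moreover have "e (Suc n) \<le> e n"
      using dec[of n] CH unfolding e_def by (smt (verit) mult_nonneg_nonneg zero_le_power2)
    ultimately show ?thesis using up[of n] by linarith
  qed
  have low: "CH * (norm (x (Suc n) - x n))\<^sup>2 \<le> e n"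
    using dec[of n] e0[of "Suc n"] unfolding e_def by linarith
  then have "(1 + inverse c) ^ n * (CH * (norm (x (Suc n) - x n))\<^sup>2) \<le> (1 + inverse c) ^ n * e n"
    using cpos by (intro mult_left_mono) auto
  also have "\<dots> \<le> e 0" by (rule geometric_decay[where e = e, OF cpos step])
  finally show "CH * ((1 + inverse c) ^ n * (norm (x (Suc n) - x n))\<^sup>2) \<le> H (x 0) - H us"
    unfolding e_def by (simp add: mult_ac)
  show "1 \<le> c" if "x (Suc n) \<noteq> x n"
  proof -
    have "CH * (norm (x (Suc n) - x n))\<^sup>2 > 0" using that CH by simp
    moreover have "1 * (CH * (norm (x (Suc n) - x n))\<^sup>2) \<le> c * (CH * (norm (x (Suc n) - x n))\<^sup>2)"
      using low up[of n] by linarith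
    ultimately show ?thesis using mult_le_cancel_right_pos by blast
  qed
qed

text \<open>Reliability at a stopped iterate: the stopping test bounds the distance to the discrete
  solution by the estimator, (A1) moves the estimator from that solution to the iterate, and (A2)
  adds the discretization error. The factor is \<open>C3\<close>.\<close>

lemma ilg_final_error:
  assumes F2: "cond_F2 F \<nu>" and lin: "\<And>v. linear (A v)"
    and bd: "uniformly_bounded A \<beta>" and S: "subspace (X N)"
    and us: "galerkin_solution F (X N) (us N)" and it: "ilg_iteration A F (X N) x"
    and A1: "cond_A1 X \<eta> a" and A2: "cond_A2 \<eta> w us b"
    and stop: "stop_crit (\<eta> N) lam x n"
  shows "norm (w - x n) \<le>
    (lam * (1 + \<beta> / \<nu>) + b * (1 + lam * ((1 + \<beta> / \<nu>) * a))) * \<eta> N (x n)"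
proof -
  obtain m where m: "n = Suc m" and d: "norm (x (Suc m) - x m) \<le> lam * \<eta> N (x n)"
    using stop unfolding stop_crit_def by (cases n) auto
  have "\<nu> > 0" "\<beta> > 0"
    using F2 bd unfolding cond_F2_def uniformly_bounded_def by blast+
  then have C1: "1 + \<beta> / \<nu> > 0" by (simp add: add_pos_pos)
  have a: "a \<ge> 1" and b: "b \<ge> 1" using A1 A2 unfolding cond_A1_def cond_A2_def by auto
  have xS: "x n \<in> X N" using it unfolding ilg_iteration_def m by auto
  have "norm (us N - x n) \<le> (1 + \<beta> / \<nu>) * norm (x (Suc m) - x m)"
    unfolding m by (rule ilg_iteration_error(2)[OF F2 lin bd S us it])
  also have "\<dots> \<le> (1 + \<beta> / \<nu>) * (lam * \<eta> N (x n))"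
    using d C1 by (intro mult_left_mono) auto
  finally have k: "norm (us N - x n) \<le> (1 + \<beta> / \<nu>) * (lam * \<eta> N (x n))" .
  have "\<bar>\<eta> N (us N) - \<eta> N (x n)\<bar> \<le> a * norm (us N - x n)"
    using A1 us xS unfolding cond_A1_def galerkin_solution_def by blast
  also have "\<dots> \<le> a * ((1 + \<beta> / \<nu>) * (lam * \<eta> N (x n)))"
    using k a by (intro mult_left_mono) auto
  finally have "\<eta> N (us N) \<le> \<eta> N (x n) + a * ((1 + \<beta> / \<nu>) * (lam * \<eta> N (x n)))" by linarith
  then have "b * \<eta> N (us N) \<le> b * (\<eta> N (x n) + a * ((1 + \<beta> / \<nu>) * (lam * \<eta> N (x n))))"
    using b by (intro mult_left_mono) auto
  moreover have "norm (w - us N) \<le> b * \<eta> N (us N)"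
    using A2 unfolding cond_A2_def by blast
  moreover have "norm (w - x n) \<le> norm (w - us N) + norm (us N - x n)"
    using norm_triangle_ineq[of "w - us N" "us N - x n"] by simp
  ultimately have "norm (w - x n) \<le>
      b * (\<eta> N (x n) + a * ((1 + \<beta> / \<nu>) * (lam * \<eta> N (x n)))) + (1 + \<beta> / \<nu>) * (lam * \<eta> N (x n))"
    using k by linarith
  also have "\<dots> = (lam * (1 + \<beta> / \<nu>) + b * (1 + lam * ((1 + \<beta> / \<nu>) * a))) * \<eta> N (x n)"
    by (simp only: distrib_left distrib_right mult_ac mult_1_left mult_1_right add_ac)
  finally show ?thesis .
qed

section \<open>Counting the steps\<close>

theorem proposition3p7:
  fixes F :: "'a::{real_inner, complete_space} \<Rightarrow> 'a \<Rightarrow>\<^sub>L real"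
    and H :: "'a \<Rightarrow> real"
    and A :: "'a \<Rightarrow> 'a \<Rightarrow> 'a \<Rightarrow>\<^sub>L real"
    and X :: "nat \<Rightarrow> 'a set"
    and \<eta> :: "nat \<Rightarrow> 'a \<Rightarrow> real"
    and u :: "nat \<Rightarrow> nat \<Rightarrow> 'a"
    and ustar :: 'a
    and uNstar :: "nat \<Rightarrow> 'a"
    and LF \<nu> \<alpha> \<beta> CH CA1 CA2 lam C1 Clam C2 C3 C C' :: real
  assumes F1: "cond_F1 F LF"
    and F2: "cond_F2 F \<nu>"
    and F3: "cond_F3 F H"
    and A_linear: "\<And>v. linear (A v)"
    and A_invertible: "\<And>v. bij (A v)"
    and coercive: "uniformly_coercive A \<alpha>"
    and bounded: "uniformly_bounded A \<beta>"
    and spaces: "\<And>N. finite_dim_subspace (X N)"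
    and nested: "\<And>N. X N \<subseteq> X (Suc N)"
    and ustar: "F ustar = 0"
    and uNstar: "\<And>N. galerkin_solution F (X N) (uNstar N)"
    and estimators: "error_estimators X \<eta>"
    and A1: "cond_A1 X \<eta> CA1"
    and A2: "cond_A2 \<eta> ustar uNstar CA2"
    and algorithm: "adaptive_ilg A F X \<eta> lam u"
    and F4: "cond_F4 H u CH"
    and C1: "C1 = 1 + \<beta> / \<nu>"
    and Clam: "Clam = C1 * CA1"
    and C2: "C2 = LF * C1\<^sup>2 / (2 * CH)"
    and lam: "0 < lam" "lam < inverse Clam"
    and C3: "C3 = lam * C1 + CA2 * (1 + lam * Clam)"
    and C: "C = sqrt LF * sqrt C2 * C3 / (sqrt 2 * sqrt CH)"
    and C': "C' = C * CA1 * sqrt C2 / (1 - (1 + inverse C2) powr (-1/2))"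
    and terminates: "\<And>N. inner_terminates (\<eta> N) lam (u N)"
    and positive: "\<And>N. \<eta> N (final_iterate (\<eta> N) lam (u N)) > 0"
  shows "\<forall>N\<ge>1. real (num_it (\<eta> N) lam (u N)) \<le>
    2 / ln (1 + inverse C2) *
      ln ((C * inverse lam + C') * (1 + inverse C2) *
          max 1 (\<eta> (N - 1) (final_iterate (\<eta> (N - 1)) lam (u (N - 1))) /
                 \<eta> N (final_iterate (\<eta> N) lam (u N)))) + 1"
proof (intro allI impI)
  fix N :: nat assume "N \<ge> 1"
  then obtain M where M: "N = Suc M" by (cases N) auto
  define x where "x = u N"
  define n where "n = num_it (\<eta> N) lam x"
  define y where "y = \<eta> M (final_iterate (\<eta> M) lam (u M))"
  define z where "z = \<eta> N (x n)"
  \<comment> \<open>\<open>r\<close> is the decay rate of energy errors and squared increments,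
    \<open>s\<close> that of the increments. \<open>K\<close> is \<open>C\<close> without its factor
    \<open>sqrt C2\<close>, as it arises from the initial energy.\<close>
  define r where "r = 1 + inverse C2"
  define s where "s = sqrt r"
  define K where "K = sqrt LF * C3 / (sqrt 2 * sqrt CH)"
  have pos: "LF > 0" "\<nu> > 0" "\<beta> > 0" "CH > 0" "CA1 \<ge> 1" "CA2 \<ge> 1"
    using F1 F2 bounded F4 A1 A2
    unfolding cond_F1_def cond_F2_def uniformly_bounded_def cond_F4_def cond_A1_def cond_A2_def
    by blast+
  have C1pos: "C1 > 0" using pos by (simp add: C1 add_pos_pos)
  have C2pos: "C2 > 0" using pos C1pos by (simp add: C2)
  have Clampos: "Clam > 0" using pos C1pos by (simp add: Clam)
  have C3pos: "C3 > 0" using pos C1pos Clampos lam by (simp add: C3 add_pos_pos)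
  have Cpos: "C > 0" using pos C2pos C3pos by (simp add: C)
  have Kpos: "K > 0" using pos C3pos by (simp add: K_def)
  have CK: "C = K * sqrt C2" by (simp add: C K_def)
  have r1: "r > 1" using C2pos by (simp add: r_def)
  then have s1: "s > 1" by (simp add: s_def)
  have gap: "0 < 1 - r powr (-1/2)" "1 - r powr (-1/2) \<le> 1"
    using r1 powr_less_mono[of "-1/2" 0 r] by auto
  have C'pos: "C' > 0" using gap Cpos pos C2pos by (simp add: C' r_def)
  have y: "y > 0" using positive[of M] by (simp add: y_def)
  have z: "z > 0" using positive[of N] by (simp add: z_def final_iterate_def n_def x_def)
  have sub: "subspace (X k)" for k
    using spaces unfolding finite_dim_subspace_def by blast
  have it: "ilg_iteration A F (X k) (u k)" for k
    using algorithm unfolding adaptive_ilg_def by blast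
  have stop: "stop_crit (\<eta> k) lam (u k) (num_it (\<eta> k) lam (u k))" for k
    using terminates[of k] unfolding inner_terminates_def num_it_def by (metis LeastI)
  have xS: "x k \<in> X N" for k
    using it[of N] unfolding ilg_iteration_def x_def by (cases k) auto
  have dec: "H (x k) - H (x (Suc k)) \<ge> CH * (norm (x (Suc k) - x k))\<^sup>2" for k
  proof -
    have "\<forall>k\<ge>1. H (x (k - 1)) - H (x k) \<ge> CH * (norm (x k - x (k - 1)))\<^sup>2"
      using F4 unfolding cond_F4_def x_def by blast
    from this[rule_format, of "Suc k"] show ?thesis by simp
  qed
  have c: "C2 = LF * (1 + \<beta> / \<nu>)\<^sup>2 / (2 * CH)" by (simp add: C2 C1)
  note decay = ilg_increment_decay[OF F1 F2 F3 A_linear bounded sub uNstar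
      it[of N, folded x_def] pos(4) dec c]
  \<comment> \<open>Warm start: \<open>x 0\<close> is the stopped iterate of level
    \<open>M\<close>.\<close>
  have "norm (ustar - x 0) \<le> C3 * y"
    using ilg_final_error[OF F2 A_linear bounded sub uNstar it A1 A2 stop, of M]
      algorithm unfolding adaptive_ilg_def x_def M y_def final_iterate_def C3 Clam C1 by simp
  then have "(norm (x 0 - ustar))\<^sup>2 \<le> (C3 * y)\<^sup>2"
    by (simp add: norm_minus_commute power_mono)
  then have "LF / 2 * (norm (x 0 - ustar))\<^sup>2 \<le> LF / 2 * (C3 * y)\<^sup>2"
    using pos by (intro mult_left_mono) auto
  then have H0: "H (x 0) - H (uNstar N) \<le> LF / 2 * (C3 * y)\<^sup>2"
    using potential_upper_bound[OF F1 F3, of "x 0" ustar]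
      potential_lower_bound[OF F2 F3, of ustar "uNstar N"] ustar by simp
  have incr: "s ^ k * norm (x (Suc k) - x k) \<le> K * y" for k
  proof (rule power2_le_imp_le)
    have "CH * (r ^ k * (norm (x (Suc k) - x k))\<^sup>2) \<le> LF / 2 * (C3 * y)\<^sup>2"
      using decay(1)[of k] H0 unfolding r_def by linarith
    then have "r ^ k * (norm (x (Suc k) - x k))\<^sup>2 \<le> LF * (C3 * y)\<^sup>2 / (2 * CH)"
      using pos by (simp add: field_simps)
    also have "\<dots> = (K * y)\<^sup>2"
      using pos by (simp add: K_def power_mult_distrib power_divide)
    also have "r ^ k = (s ^ k)\<^sup>2"
      using r1 by (simp add: s_def power_mult[symmetric] mult.commute[of k]) (simp add: power_mult)
    finally show "(s ^ k * norm (x (Suc k) - x k))\<^sup>2 \<le> (K * y)\<^sup>2"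
      by (simp add: power_mult_distrib)
  qed (use Kpos y in auto)
  define B where "B = (C * inverse lam + C') * max 1 (y / z)"
  have Bpos: "B > 0" using Cpos C'pos lam by (simp add: B_def add_pos_pos)
  \<comment> \<open>Makes the logarithm in the claim nonnegative. Inserting \<open>C2\<close> gives
    \<open>C = C2 * C3 / C1\<close>; with \<open>lam * C1 \<le> C3\<close> this yields
    \<open>C2 \<le> C * inverse lam\<close>, and \<open>r * C2 = C2 + 1\<close>.\<close>
  have rB: "1 \<le> r * B"
  proof -
    have "C = C2 * C3 / C1"
    proof -
      have "sqrt C2 = sqrt LF * C1 / (sqrt 2 * sqrt CH)"
        using C1pos by (simp add: C2 real_sqrt_divide real_sqrt_mult)
      then have "C * C1 = (sqrt LF * C1 / (sqrt 2 * sqrt CH))\<^sup>2 * C3"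
        by (simp add: C power2_eq_square)
      also have "\<dots> = C2 * C3"
        using pos by (simp add: C2 power_divide power_mult_distrib)
      finally show ?thesis using C1pos by (simp add: field_simps)
    qed
    moreover have "lam * C1 \<le> C3" using pos lam Clampos by (simp add: C3)
    then have "C2 * (lam * C1) / C1 \<le> C2 * C3 / C1"
      using C1pos C2pos by (intro divide_right_mono mult_left_mono) auto
    ultimately have "C2 * (lam * C1) / C1 \<le> C" by simp
    then have "C2 \<le> C * inverse lam"
      using lam C1pos by (simp add: field_simps)
    then have "C2 \<le> C * inverse lam + C'" using C'pos by linarith
    then have "r * C2 \<le> r * B"
      unfolding B_def using r1 C2pos mult_mono[of C2 "C * inverse lam + C'" 1 "max 1 (y / z)"]
      by (intro mult_left_mono) auto
    moreover have "r * C2 = C2 + 1" using C2pos by (simp add: r_def field_simps)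
    ultimately show ?thesis using C2pos by linarith
  qed
  have "real n \<le> 2 / ln r * ln (r * B) + 1"
  \<comment> \<open>For \<open>n \<le> 1\<close> there is no failed test to exploit, since testing
    starts at index 1; the final summand 1 covers this case.\<close>
  proof (cases "n \<le> 1")
    case True
    then have "real n \<le> 1" by simp
    moreover have "0 \<le> 2 / ln r * ln (r * B)" using rB r1 by simp
    ultimately show ?thesis by linarith
  next
    case False
    \<comment> \<open>The test failed at \<open>n - 1 = Suc m\<close>, so the increments from
      \<open>x m\<close> and from \<open>x (Suc m)\<close> are the two to be used.\<close>
    define m where "m = n - 2"
    have n: "n = Suc (Suc m)" using False by (simp add: m_def)
    have "\<not> stop_crit (\<eta> N) lam x (Suc m)"
      using not_less_Least[of "Suc m" "stop_crit (\<eta> N) lam x"] n unfolding n_def num_it_def by simp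
    then have go: "lam * \<eta> N (x (Suc m)) < norm (x (Suc m) - x m)"
      unfolding stop_crit_def by simp
    moreover have "\<eta> N (x (Suc m)) \<ge> 0"
      using estimators xS unfolding error_estimators_def by blast
    ultimately have "0 < norm (x (Suc m) - x m)" using lam by (smt (verit) mult_nonneg_nonneg)
    then have C2ge: "1 \<le> C2" using decay(2)[of m] by auto
    have KC: "K \<le> C" unfolding CK using Kpos C2ge by simp
    have "C * CA1 * 1 \<le> C * CA1 * sqrt C2" using Cpos pos C2ge by (intro mult_left_mono) auto
    also have "\<dots> \<le> C'"
      unfolding C' r_def[symmetric] using gap Cpos pos C2pos by (simp add: le_divide_eq mult_left_le)
    finally have C'ge: "CA1 * C \<le> C'" by (simp add: mult.commute)
    \<comment> \<open>(A1) compares the estimator with its value one step earlier, where the failed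
      test bounds it by an increment.\<close>
    have "\<bar>\<eta> N (x n) - \<eta> N (x (Suc m))\<bar> \<le> CA1 * norm (x n - x (Suc m))"
      using A1 xS unfolding cond_A1_def by blast
    moreover have "\<eta> N (x (Suc m)) \<le> inverse lam * norm (x (Suc m) - x m)"
      using go lam by (simp add: field_simps)
    ultimately have "z \<le> inverse lam * norm (x (Suc m) - x m) + CA1 * norm (x n - x (Suc m))"
      unfolding z_def by linarith
    then have "s ^ m * z \<le>
        s ^ m * (inverse lam * norm (x (Suc m) - x m) + CA1 * norm (x n - x (Suc m)))"
      using s1 by (intro mult_left_mono) auto
    also have "\<dots> = inverse lam * (s ^ m * norm (x (Suc m) - x m))
        + CA1 * (s ^ m * norm (x n - x (Suc m)))" by (simp add: algebra_simps)
    also have "\<dots> \<le> inverse lam * (K * y) + CA1 * (K * y)"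
    proof (intro add_mono mult_left_mono)
      \<comment> \<open>The later increment decays by one more factor \<open>s > 1\<close>, which is
        given away.\<close>
      have "s ^ m * norm (x n - x (Suc m)) \<le> s ^ Suc m * norm (x n - x (Suc m))"
        using s1 by (intro mult_right_mono power_increasing) auto
      then show "s ^ m * norm (x n - x (Suc m)) \<le> K * y"
        using incr[of "Suc m"] unfolding n by linarith
    qed (use incr[of m] lam pos in auto)
    also have "\<dots> \<le> inverse lam * (C * y) + CA1 * (C * y)"
      using KC y lam pos by (intro add_mono mult_left_mono mult_right_mono) auto
    also have "\<dots> \<le> (C * inverse lam + C') * y"
      using mult_right_mono[OF C'ge, of y] y by (simp add: algebra_simps)
    finally have "s ^ m \<le> (C * inverse lam + C') * (y / z)"
      using z by (simp add: field_simps)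
    also have "\<dots> \<le> B"
      unfolding B_def using Cpos C'pos lam by (intro mult_left_mono) auto
    finally have "ln (s ^ m) \<le> ln B" using s1 Bpos by simp
    then have "real m * (ln r / 2) \<le> ln B"
      using s1 r1 by (simp add: ln_realpow s_def ln_sqrt)
    then have "real m \<le> 2 / ln r * ln B" using r1 by (simp add: field_simps)
    \<comment> \<open>The factor \<open>1 + inverse C2\<close> inside the logarithm contributes
      exactly the 2 that leads from \<open>m\<close> back to \<open>n\<close>.\<close>
    moreover have "2 / ln r * ln (r * B) = 2 + 2 / ln r * ln B"
      using r1 Bpos by (simp add: ln_mult field_simps)
    ultimately show ?thesis unfolding n by simp
  qed
  then show "real (num_it (\<eta> N) lam (u N)) \<le>
    2 / ln (1 + inverse C2) *
      ln ((C * inverse lam + C') * (1 + inverse C2) *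
          max 1 (\<eta> (N - 1) (final_iterate (\<eta> (N - 1)) lam (u (N - 1))) /
                 \<eta> N (final_iterate (\<eta> N) lam (u N)))) + 1"
    unfolding B_def r_def n_def z_def y_def x_def M final_iterate_def
    by (simp add: mult_ac)
qed

end
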